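(* Let $\mathbf{M} = (h_{\alpha\beta}) \in \mathbb{R}^{l \times w}$ be a real matrix subject to a total of $q$ structural constraints, each belonging to one of the following two classes: (1) specified elements, i.e. $h_{\alpha\beta} = b_0$, where $h_{\alpha\beta}$ is the $(\alpha,\beta)$-th element of $\mathbf{M}$ and $b_0$ is a specific constant (e.g. $0$ or $1$); (2) repetitive elements, i.e. $h_{\alpha_1\beta_1} = h_{\alpha_2\beta_2}$, where $(\alpha_1,\beta_1) \neq (\alpha_2,\beta_2)$. Then, in $\operatorname{vec}(\mathbf{M})$, these structural constraints are linear and can be expressed as $$\mathbf{Q}^{\top} \operatorname{vec}(\mathbf{M}) = \mathbf{b},$$ where $\mathbf{Q} = [\mathbf{q}_1 \ \mathbf{q}_2 \ \dots \ \mathbf{q}_q] \in \mathbb{R}^{lw \times q}$, with columns $\mathbf{q}_j \in \mathbb{R}^{lw}$, is a matrix of $\operatorname{rank}(\mathbf{Q}) = q$ for the total of $q$ constraints, and $\mathbf{b} \in \mathbb{R}^{q}$, $\mathbf{b}^{\top} = [b_1 \ b_2 \ \dots \ b_q]$ with $b_j \in \mathbb{R}$, is a vector of known constants.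
   Context: For $\mathbf{M} = (h_{\alpha\beta}) \in \mathbb{R}^{l\times w}$, $\operatorname{vec}(\mathbf{M}) = [h_{11}, h_{21}, \dots, h_{l1}, h_{12}, h_{22}, \dots, h_{l2}, \dots, h_{1w}, h_{2w}, \dots, h_{lw}]^{\top} \in \mathbb{R}^{lw}$ denotes the vectorization of $\mathbf{M}$, in which the columns of $\mathbf{M}$ are stacked one after another into a column vector of length $lw$.
   Formalization: It is additionally assumed that none of the q structural constraints is implied by the others; without this rank(Q) = q can fail, e.g. when the same constraint is listed twice or three elements are equated pairwise. *)

theory Defs
  imports "Jordan_Normal_Form.DL_Rank"
begin

text \<open>Column-major vectorization. Indices start at 0, so the entry in row \<open>i\<close> and column \<open>j\<close>
  of an \<open>l \<times> w\<close> matrix is put at position \<open>j * l + i\<close>.\<close>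

definition vectorize :: "'a mat \<Rightarrow> 'a vec" where
  "vectorize M = vec (dim_row M * dim_col M) (\<lambda>k. M $$ (k mod dim_row M, k div dim_row M))"

datatype structural_constraint =
    Specified "nat \<times> nat" real
  | Repeated "nat \<times> nat" "nat \<times> nat"

fun wf_constraint :: "nat \<Rightarrow> nat \<Rightarrow> structural_constraint \<Rightarrow> bool" where
  "wf_constraint l w (Specified p b0) \<longleftrightarrow> p \<in> {..<l} \<times> {..<w}"
| "wf_constraint l w (Repeated p p') \<longleftrightarrow>
     p \<in> {..<l} \<times> {..<w} \<and> p' \<in> {..<l} \<times> {..<w} \<and> p \<noteq> p'"

fun satisfies :: "real mat \<Rightarrow> structural_constraint \<Rightarrow> bool" where
  "satisfies M (Specified p b0) \<longleftrightarrow> M $$ p = b0"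
| "satisfies M (Repeated p p') \<longleftrightarrow> M $$ p = M $$ p'"

text \<open>No constraint is a consequence of the other ones. Without this, the coefficient vectors
  can be linearly dependent: the same constraint may be listed twice, or three entries may be
  equated pairwise.\<close>

definition irredundant :: "nat \<Rightarrow> nat \<Rightarrow> nat \<Rightarrow> (nat \<Rightarrow> structural_constraint) \<Rightarrow> bool" where
  "irredundant l w q c \<longleftrightarrow>
     (\<forall>j<q. \<exists>N\<in>carrier_mat l w. (\<forall>i<q. i \<noteq> j \<longrightarrow> satisfies N (c i)) \<and> \<not> satisfies N (c j))"

end

theory Submission
  imports Defs
begin

text \<open>The coefficient vector of a constraint is a unit vector or a difference of two unit vectors.
  If \<open>N\<close> violates the \<open>j\<close>-th constraint and satisfies all the others, then
  \<open>vectorize N - vectorize M\<close> is orthogonal to every coefficient vector except the \<open>j\<close>-th one.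
  So irredundancy provides a family dual (up to scaling) to the columns of \<open>Q\<close>, which are
  therefore linearly independent.\<close>

text \<open>Pairing a relation \<open>A *\<^sub>v v = 0\<^sub>v n\<close> with the vector
  \<open>d\<close> chosen for \<open>j\<close> leaves only a nonzero multiple of
  \<open>v $ j\<close>. Independence is stated for the set of columns, so their distinctness is a
  separate obligation.\<close>

lemma (in vec_space) full_rank_if_dual_family:
  assumes A: "A \<in> carrier_mat n nc"
    and dual: "\<And>j. j < nc \<Longrightarrow> \<exists>d\<in>carrier_vec n.
      (\<forall>i<nc. i \<noteq> j \<longrightarrow> col A i \<bullet> d = 0) \<and> col A j \<bullet> d \<noteq> 0"
  shows "rank A = nc"
proof (rule lin_indpt_full_rank[OF A])
  show distinct: "distinct (cols A)"
    unfolding distinct_conv_nth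
  proof (intro allI impI)
    fix i j assume "i < length (cols A)" "j < length (cols A)" "i \<noteq> j"
    with A have ij: "i < nc" "j < nc" "i \<noteq> j" by auto
    \<comment> \<open>The vector \<open>d\<close> for \<open>j\<close> separates the two columns:
      its product with column \<open>i\<close> is zero, with column \<open>j\<close>
      nonzero.\<close>
    from dual[OF ij(2)] ij have "col A i \<noteq> col A j" by auto
    with ij A show "cols A ! i \<noteq> cols A ! j" by simp
  qed
  show "lin_indpt (set (cols A))"
  proof
    assume "lin_dep (set (cols A))"
    then obtain v where v: "v \<in> carrier_vec nc" "v \<noteq> 0\<^sub>v nc" "A *\<^sub>v v = 0\<^sub>v n"
      using lin_depE[OF A _ distinct] by blast
    have "v $ j = 0" if j: "j < nc" for j
    proof -
      from dual[OF j] obtain d where d: "d \<in> carrier_vec n"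
        "\<And>i. i < nc \<Longrightarrow> i \<noteq> j \<Longrightarrow> col A i \<bullet> d = 0" "col A j \<bullet> d \<noteq> 0"
        by blast
      have "0 = (transpose_mat A *\<^sub>v d) \<bullet> v"
        using transpose_vec_mult_scalar[OF A v(1) d(1)] v(3) d(1) by simp
      also have "\<dots> = (\<Sum>i<nc. (col A i \<bullet> d) * v $ i)"
        using A v(1) by (simp add: scalar_prod_def atLeast0LessThan)
      also have "\<dots> = (\<Sum>i\<in>{j}. (col A i \<bullet> d) * v $ i)"
        using j d(2) by (intro sum.mono_neutral_right) auto
      finally show ?thesis using d(3) by simp
    qed
    then have "v = 0\<^sub>v nc" using v(1) by (intro eq_vecI) auto
    with v(2) show False by contradiction
  qed
qed

lemma vectorize_carrier [simp]:
  "N \<in> carrier_mat l w \<Longrightarrow> vectorize N \<in> carrier_vec (l * w)"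
  by (auto simp: vectorize_def)

text \<open>Inverse of the index map in \<open>vectorize\<close>: for \<open>i < l\<close>, the
  remainder and quotient by \<open>l\<close> recover \<open>i\<close> and \<open>j\<close>.\<close>

fun vec_index :: "nat \<Rightarrow> nat \<times> nat \<Rightarrow> nat" where
  "vec_index l (i, j) = j * l + i"

lemma vec_index_less:
  assumes "p \<in> {..<l} \<times> {..<w}"
  shows "vec_index l p < l * w"
proof -
  obtain i j where p: "p = (i, j)" "i < l" "j < w" using assms by auto
  have "j * l + i < Suc j * l" using p(2) by simp
  also have "\<dots> \<le> w * l" using p(3) by (intro mult_le_mono1) simp
  finally show ?thesis using p(1) by (simp add: mult.commute)
qed

lemma vectorize_nth_vec_index:
  assumes "N \<in> carrier_mat l w" "p \<in> {..<l} \<times> {..<w}"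
  shows "vectorize N $ vec_index l p = N $$ p"
  using assms vec_index_less[OF assms(2)] by (auto simp: vectorize_def)

fun coeff_vec :: "nat \<Rightarrow> nat \<Rightarrow> structural_constraint \<Rightarrow> real vec" where
  "coeff_vec l w (Specified p b0) = unit_vec (l * w) (vec_index l p)"
| "coeff_vec l w (Repeated p p') =
     unit_vec (l * w) (vec_index l p) - unit_vec (l * w) (vec_index l p')"

fun rhs :: "structural_constraint \<Rightarrow> real" where
  "rhs (Specified p b0) = b0"
| "rhs (Repeated p p') = 0"

lemma coeff_vec_carrier [simp]: "coeff_vec l w k \<in> carrier_vec (l * w)"
  by (cases k) auto

text \<open>A product with a unit vector reads off one entry of \<open>vectorize N\<close>, hence
  one entry of \<open>N\<close>; for a repetition, the difference of two entries is compared with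
  0.\<close>

lemma satisfies_iff_coeff_vec:
  assumes N: "N \<in> carrier_mat l w" and "wf_constraint l w k"
  shows "satisfies N k \<longleftrightarrow> coeff_vec l w k \<bullet> vectorize N = rhs k"
proof (cases k)
  case (Specified p b0)
  then show ?thesis
    using assms scalar_prod_left_unit[OF vectorize_carrier[OF N]]
    by (simp add: vec_index_less vectorize_nth_vec_index del: mem_Sigma_iff)
next
  case (Repeated p p')
  with assms have p: "p \<in> {..<l} \<times> {..<w}" "p' \<in> {..<l} \<times> {..<w}" by auto
  have "coeff_vec l w k \<bullet> vectorize N = N $$ p - N $$ p'"
    using Repeated vectorize_carrier[OF N] N p
    by (simp add: minus_scalar_prod_distrib[of _ "l * w"] vec_index_less vectorize_nth_vec_index
        del: mem_Sigma_iff)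
  with Repeated show ?thesis by simp
qed

text \<open>The clause over all \<open>N\<close> ties \<open>Q\<close> and \<open>b\<close> to the
  constraints: for \<open>M\<close> alone, any \<open>Q\<close> of rank \<open>q\<close> would do,
  with \<open>b\<close> defined as the product.\<close>

theorem lemma3:
  fixes M :: "real mat" and l w q :: nat and c :: "nat \<Rightarrow> structural_constraint"
  assumes "M \<in> carrier_mat l w"
    and "\<forall>j<q. wf_constraint l w (c j)"
    and "\<forall>j<q. satisfies M (c j)"
    and "irredundant l w q c"
  shows "\<exists>Q\<in>carrier_mat (l * w) q. \<exists>b\<in>carrier_vec q.
           vec_space.rank (l * w) Q = q \<and>
           transpose_mat Q *\<^sub>v vectorize M = b \<and>
           (\<forall>N\<in>carrier_mat l w.
              (\<forall>j<q. satisfies N (c j) \<longleftrightarrow> col Q j \<bullet> vectorize N = b $ j) \<and>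
              ((\<forall>j<q. satisfies N (c j)) \<longleftrightarrow> transpose_mat Q *\<^sub>v vectorize N = b))"
proof -
  \<comment> \<open>Both \<open>Q\<close> and \<open>b\<close> are read off from the constraints,
    independently of \<open>M\<close>.\<close>
  define Q where "Q = mat_of_cols (l * w) (map (\<lambda>j. coeff_vec l w (c j)) [0..<q])"
  define b where "b = vec q (\<lambda>j. rhs (c j))"
  have Q: "Q \<in> carrier_mat (l * w) q" by (simp add: Q_def mat_of_cols_def)
  have b: "b \<in> carrier_vec q" by (simp add: b_def)
  have col: "col Q j = coeff_vec l w (c j)" if "j < q" for j
    using that by (simp add: Q_def)
  have single: "satisfies N (c j) \<longleftrightarrow> col Q j \<bullet> vectorize N = b $ j"
    if "N \<in> carrier_mat l w" "j < q" for N j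
    using satisfies_iff_coeff_vec[OF that(1)] assms(2) that(2) by (simp add: col b_def)
  have all: "(\<forall>j<q. satisfies N (c j)) \<longleftrightarrow> transpose_mat Q *\<^sub>v vectorize N = b"
    if "N \<in> carrier_mat l w" for N
    using Q b single[OF that] by (auto simp: vec_eq_iff)
  have "vec_space.rank (l * w) Q = q"
  proof (rule vec_space.full_rank_if_dual_family[OF Q])
    fix j assume j: "j < q"
    with assms(4) obtain N where N: "N \<in> carrier_mat l w"
      "\<And>i. i < q \<Longrightarrow> i \<noteq> j \<Longrightarrow> satisfies N (c i)" "\<not> satisfies N (c j)"
      unfolding irredundant_def by blast
    \<comment> \<open>Since \<open>M\<close> meets every constraint, subtracting
      \<open>vectorize M\<close> cancels the right-hand sides and turns the affine conditions into
      orthogonality.\<close>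
    let ?d = "vectorize N - vectorize M"
    have d: "col Q i \<bullet> ?d = col Q i \<bullet> vectorize N - b $ i" if "i < q" for i
      using single[OF assms(1) that] assms(3) that vectorize_carrier[OF N(1)]
        vectorize_carrier[OF assms(1)]
      by (simp add: scalar_prod_minus_distrib[of _ "l * w"] col)
    show "\<exists>d\<in>carrier_vec (l * w).
        (\<forall>i<q. i \<noteq> j \<longrightarrow> col Q i \<bullet> d = 0) \<and> col Q j \<bullet> d \<noteq> 0"
      using d single[OF N(1)] N assms(1) j by (intro bexI[of _ ?d]) auto
  qed
  with Q b single all assms(1,3) show ?thesis by blast
qed

end
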